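(* If both $\hat{\mathbf{x}}^{(m)}$ and $\hat{\mathbf{z}}^{(m)}$ ($m\ge1$) are bounded sequences in $(\mathbb{L},\|\cdot\|_\infty)$, then for any subsequence $\{(\hat{\mathbf{x}}^{(m')},\hat{\mathbf{z}}^{(m')})\}\subset\{(\hat{\mathbf{x}}^{(m)},\hat{\mathbf{z}}^{(m)})\}$, there exist a further subsequence $\{(\hat{\mathbf{x}}^{(m'')},\hat{\mathbf{z}}^{(m'')})\}\subset\{(\hat{\mathbf{x}}^{(m')},\hat{\mathbf{z}}^{(m')})\}$ and $$(\hat{\mathbf{x}}^{(\infty)},\hat{\mathbf{z}}^{(\infty)})\in\operatorname*{arg\,min}_{\hat{\mathbf{x}},\hat{\mathbf{z}}\in\mathbb{L},\ \hat{\mathbf{x}}(0)=x,\ \hat{\mathbf{z}}(0)=z}J(\hat{\mathbf{x}},\hat{\mathbf{z}},\theta),$$ such that $$\lim_{m''\to\infty}\|\hat{\mathbf{x}}^{(m'')}-\hat{\mathbf{x}}^{(\infty)}\|_\infty=0,\qquad\lim_{m''\to\infty}\|\hat{\mathbf{z}}^{(m'')}-\hat{\mathbf{z}}^{(\infty)}\|_\infty=0.$$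
   Context: Let $T>0$, $\Theta\subset\mathbb{R}^d$ open and convex, $\Gamma\subset\mathbb{R}\times\mathbb{R}$ open and convex, $F,G\in C^3(\mathbb{R}\times\mathbb{R}\times[0,T]\times\Theta)$ real valued, and $g:\mathbb{R}\times\mathbb{R}\to[0,\infty)$ continuous. Fix a sample $(Y_1,T_1),\ldots,(Y_n,T_n)\in\mathbb{R}\times[0,T]$ and $\theta^*=(\theta,x,z)\in\Theta\times\Gamma$. For a function $\mathbf{f}$ on $[0,T]$, $H_n(\mathbf{f})=-\frac1n\sum_{i=1}^ng(Y_i,\mathbf{f}(T_i))$. For $\mathbf{x},\mathbf{z}\in C^1[0,T]$, $$J(\mathbf{x},\mathbf{z},\theta)=\int_0^T\Big[\frac{d\mathbf{x}}{dt}-F(\mathbf{x}(t),\mathbf{z}(t),t,\theta)\Big]^2dt+\int_0^T\Big[\frac{d\mathbf{z}}{dt}-G(\mathbf{x}(t),\mathbf{z}(t),t,\theta)\Big]^2dt.$$ $\mathbb{L}$ is a finite-dimensional linear subspace of $C^1[0,T]$; $\|f\|_\infty=\sup_{t\in[0,T]}|f(t)|$. Let $\lambda^{(m)}$ be a strictly increasing sequence of positive numbers tending to infinity. For each $m$, $(\hat{\mathbf{x}}^{(m)},\hat{\mathbf{z}}^{(m)})$ is a maximizer (assumed to exist) of $H_n(\hat{\mathbf{x}})-\lambda^{(m)}J(\hat{\mathbf{x}},\hat{\mathbf{z}},\theta)$ over $\hat{\mathbf{x}},\hat{\mathbf{z}}\in\mathbb{L}$ with $\hat{\mathbf{x}}(0)=x$,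 $\hat{\mathbf{z}}(0)=z$. *)

theory Defs
  imports "HOL-Analysis.Analysis" "HOL-Library.Function_Algebras"
begin

text \<open>
  Pointwise scaling makes functions into a real vector space, so that \<^const>\<open>subspace\<close> and
  \<^const>\<open>span\<close> apply to sets of functions.
\<close>

instantiation "fun" :: (type, real_vector) real_vector
begin

definition scaleR_fun :: "real \<Rightarrow> ('a \<Rightarrow> 'b) \<Rightarrow> 'a \<Rightarrow> 'b" where
  "scaleR_fun c f = (\<lambda>t. c *\<^sub>R f t)"

instance
  by standard (auto simp: scaleR_fun_def fun_eq_iff algebra_simps)

end

text \<open>
  The derivative on \<open>[0, T]\<close>, one-sided at the endpoints; it depends only on the values of the
  function on \<open>[0, T]\<close>.
\<close>

definition deriv_on :: "real \<Rightarrow> (real \<Rightarrow> real) \<Rightarrow> real \<Rightarrow> real" where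
  "deriv_on T f t = vector_derivative f (at t within {0..T})"

text \<open>
  The space \<open>C\<^sup>1[0, T]\<close>. A function on \<open>[0, T]\<close> is represented by its extension by zero to the
  real line. The representation is unique, so linear subspaces, spans and dimensions are
  those of the function space on \<open>[0, T]\<close>.
\<close>

definition C1_fun :: "real \<Rightarrow> (real \<Rightarrow> real) set" where
  "C1_fun T = {f. (\<forall>t. t \<notin> {0..T} \<longrightarrow> f t = 0) \<and>
      (\<forall>t\<in>{0..T}. f differentiable (at t within {0..T})) \<and>
      continuous_on {0..T} (deriv_on T f)}"

definition finite_dim_subspace :: "'v::real_vector set \<Rightarrow> bool" where
  "finite_dim_subspace L \<longleftrightarrow> subspace L \<and> (\<exists>B. finite B \<and> span B = L)"

definition sup_norm :: "real \<Rightarrow> (real \<Rightarrow> real) \<Rightarrow> real" where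
  "sup_norm T f = (SUP t\<in>{0..T}. \<bar>f t\<bar>)"

text \<open>
  Real-valued functions of class \<open>C\<^sup>k\<close> on a set: all iterated directional derivatives up to order
  \<open>k\<close> exist as Frechet derivatives relative to the set and are continuous on it. It is meant for
  convex sets with nonempty interior, where derivatives relative to the set are unique.
\<close>

primrec Ck_on :: "nat \<Rightarrow> ('a::euclidean_space \<Rightarrow> real) \<Rightarrow> 'a set \<Rightarrow> bool" where
  "Ck_on 0 f S \<longleftrightarrow> continuous_on S f"
| "Ck_on (Suc k) f S \<longleftrightarrow>
     (\<exists>f'. (\<forall>p\<in>S. (f has_derivative f' p) (at p within S)) \<and> (\<forall>v. Ck_on k (\<lambda>p. f' p v) S))"

definition fit :: "(real \<times> real \<Rightarrow> real) \<Rightarrow> nat \<Rightarrow> (nat \<Rightarrow> real) \<Rightarrow> (nat \<Rightarrow> real) \<Rightarrow>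
    (real \<Rightarrow> real) \<Rightarrow> real" where
  "fit g n Y \<tau> f = - (1 / real n) * (\<Sum>i=1..n. g (Y i, f (\<tau> i)))"

definition ode_penalty :: "real \<Rightarrow> (real \<times> real \<times> real \<times> 'p \<Rightarrow> real) \<Rightarrow>
    (real \<times> real \<times> real \<times> 'p \<Rightarrow> real) \<Rightarrow> 'p \<Rightarrow> (real \<Rightarrow> real) \<times> (real \<Rightarrow> real) \<Rightarrow> real" where
  "ode_penalty T F G \<theta> = (\<lambda>(u, v).
     integral {0..T} (\<lambda>t. (deriv_on T u t - F (u t, v t, t, \<theta>))\<^sup>2) +
     integral {0..T} (\<lambda>t. (deriv_on T v t - G (u t, v t, t, \<theta>))\<^sup>2))"

definition admissible :: "(real \<Rightarrow> real) set \<Rightarrow> real \<Rightarrow> real \<Rightarrow>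
    (real \<Rightarrow> real) \<times> (real \<Rightarrow> real) \<Rightarrow> bool" where
  "admissible L x z = (\<lambda>(u, v). u \<in> L \<and> v \<in> L \<and> u 0 = x \<and> v 0 = z)"

end

theory Submission
  imports Defs
begin

text \<open>
  A maximizer of the fit minus \<open>\<lambda>\<close> times the penalty beats every admissible competitor
  \<open>(u, v)\<close>. The fit is nonpositive, so dividing by \<open>\<lambda>\<close> bounds the penalty of the maximizer by
  \<open>J(u, v) - H(u) / \<lambda>\<close>, and the last term vanishes as \<open>\<lambda>\<close> tends to infinity. Hence every limit
  of maximizers minimizes \<open>J\<close>, provided that \<open>J\<close> is continuous along the convergence and that
  the maximizers have convergent subsequences.

  Both provisos come from the finite dimension of the space \<open>L\<close>, in a form that avoids norms and
  bases: there are finitely many nodes \<open>p\<^sub>i\<close> and functions \<open>e\<^sub>i\<close> in \<open>L\<close> with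
  \<open>f = \<Sum>\<^sub>i f(p\<^sub>i) e\<^sub>i\<close> for all \<open>f\<close> in \<open>L\<close> (lemma \<open>finite_span_interpolation\<close>). A sup-bounded
  sequence in \<open>L\<close> has bounded values at each node, so along a subsequence these finitely many
  values converge. The formula then gives uniform convergence of the functions, and, after
  differentiating the \<open>e\<^sub>i\<close>, of the derivatives as well. As \<open>F\<close> and \<open>G\<close>
  are continuous, \<open>J\<close> converges along with them (lemma \<open>integral_squared_residual_tendsto\<close>).
\<close>

section \<open>Interpolation in finite-dimensional function spaces\<close>

lemma sum_fun_apply: "(\<Sum>i\<in>I. h i) t = (\<Sum>i\<in>I. h i t)"
  for h :: "'i \<Rightarrow> 'a \<Rightarrow> real"
  by (induction I rule: infinite_finite_induct) auto

lemma scaleR_fun_apply: "(c *\<^sub>R f) t = c * f t"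
  for f :: "'a \<Rightarrow> real"
  by (simp add: scaleR_fun_def)

text \<open>
  One more generator \<open>b\<close> requires at most one more node. If interpolation at the old nodes
  reproduces \<open>b\<close>, nothing has to change. Otherwise the interpolation error \<open>r\<close> of \<open>b\<close> is nonzero
  at some point \<open>q\<close>; the error of any function in the larger span is a multiple of \<open>r\<close>, and its
  value at \<open>q\<close> tells which one. The nodes are indexed by numbers, so
  that a point may occur among them more than once.
\<close>

lemma finite_span_interpolation:
  fixes B :: "('a \<Rightarrow> real) set"
  assumes "finite B"
  shows "\<exists>N (p :: nat \<Rightarrow> 'a) e. (\<forall>i<N. e i \<in> span B) \<and>
           (\<forall>h\<in>span B. \<forall>t. h t = (\<Sum>i<N. h (p i) * e i t))"
  using assms
proof induction
  case empty
  show ?case by (rule exI[of _ 0]) auto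
next
  case (insert b B)
  from insert.IH obtain N e and p :: "nat \<Rightarrow> 'a" where e: "\<And>i. i < N \<Longrightarrow> e i \<in> span B"
    and interp: "\<And>h t. h \<in> span B \<Longrightarrow> h t = (\<Sum>i<N. h (p i) * e i t)"
    by metis
  define r where "r t = b t - (\<Sum>i<N. b (p i) * e i t)" for t
  have sub: "span B \<subseteq> span (insert b B)" by (rule span_mono) auto
  have error: "\<exists>c. \<forall>t. h t = (\<Sum>i<N. h (p i) * e i t) + c * r t"
    if "h \<in> span (insert b B)" for h
  proof -
    obtain c where "h - c *\<^sub>R b \<in> span B"
      using \<open>h \<in> span (insert b B)\<close> span_breakdown_eq by blast
    then have "(h - c *\<^sub>R b) t = (\<Sum>i<N. (h - c *\<^sub>R b) (p i) * e i t)" for t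
      by (rule interp)
    then have "h t - c * b t = (\<Sum>i<N. h (p i) * e i t) - c * (\<Sum>i<N. b (p i) * e i t)" for t
      by (simp add: scaleR_fun_apply left_diff_distrib sum_subtractf sum_distrib_left mult.assoc)
    then show ?thesis unfolding r_def
      by (intro exI[of _ c]) (auto simp: algebra_simps)
  qed
  have r_in: "r \<in> span (insert b B)"
  proof -
    have "r = b - (\<Sum>i<N. b (p i) *\<^sub>R e i)"
      by (simp add: fun_eq_iff r_def sum_fun_apply scaleR_fun_apply)
    moreover have "(\<Sum>i<N. b (p i) *\<^sub>R e i) \<in> span (insert b B)"
      using e sub by (intro span_sum span_scale) auto
    ultimately show ?thesis by (simp add: span_diff span_base)
  qed
  show ?case
  proof (cases "\<forall>t. r t = 0")
    case True
    then have "\<forall>h\<in>span (insert b B). \<forall>t. h t = (\<Sum>i<N. h (p i) * e i t)"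
      using error by fastforce
    moreover have "\<forall>i<N. e i \<in> span (insert b B)"
      using e sub by auto
    ultimately show ?thesis by blast
  next
    case False
    then obtain q where q: "r q \<noteq> 0" by blast
    \<comment> \<open>The multiple of \<open>r\<close> is \<open>(h q - \<Sum>\<^sub>i h (p i) e\<^sub>i(q)) / r q\<close>; collecting it by the values of
      \<open>h\<close> corrects each old \<open>e\<^sub>i\<close> and adds one new function for \<open>q\<close>.\<close>
    define e' where
      "e' i = (if i < N then e i - (e i q / r q) *\<^sub>R r else (1 / r q) *\<^sub>R r)" for i
    define p' where "p' i = (if i < N then p i else q)" for i
    have "e' i \<in> span (insert b B)" if "i < Suc N" for i
      using e r_in sub unfolding e'_def by (auto intro!: span_diff span_scale)
    moreover have "h t = (\<Sum>i<Suc N. h (p' i) * e' i t)" if h: "h \<in> span (insert b B)" for h t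
    proof -
      obtain c where c: "\<And>t. h t = (\<Sum>i<N. h (p i) * e i t) + c * r t"
        using error[OF h] by blast
      have c_eq: "c = (h q - (\<Sum>i<N. h (p i) * e i q)) / r q"
        using c[of q] q by (simp add: field_simps)
      have "(\<Sum>i<Suc N. h (p' i) * e' i t)
          = (\<Sum>i<N. h (p i) * e i t - h (p i) * e i q * (r t / r q)) + h q * (r t / r q)"
        by (simp add: p'_def e'_def scaleR_fun_apply algebra_simps)
      also have "\<dots> = (\<Sum>i<N. h (p i) * e i t) + c * r t"
        by (simp add: c_eq sum_subtractf sum_distrib_right diff_divide_distrib
            left_diff_distrib sum_divide_distrib)
      finally show ?thesis using c[of t] by simp
    qed
    ultimately show ?thesis by blast
  qed
qed

section \<open>Uniform convergence\<close>

lemma uniform_limit_Pair: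
  assumes f: "uniform_limit S f l F" and g: "uniform_limit S g m F"
  shows "uniform_limit S (\<lambda>n t. (f n t, g n t)) (\<lambda>t. (l t, m t)) F"
proof (rule uniform_limitI)
  fix \<epsilon> :: real assume "\<epsilon> > 0"
  then have "\<forall>\<^sub>F n in F. \<forall>t\<in>S. dist (f n t) (l t) < \<epsilon> / 2"
    and "\<forall>\<^sub>F n in F. \<forall>t\<in>S. dist (g n t) (m t) < \<epsilon> / 2"
    using uniform_limitD[OF f, of "\<epsilon> / 2"] uniform_limitD[OF g, of "\<epsilon> / 2"] by simp_all
  then show "\<forall>\<^sub>F n in F. \<forall>t\<in>S. dist (f n t, g n t) (l t, m t) < \<epsilon>"
  proof eventually_elim
    case (elim n)
    show ?case
    proof
      fix t assume "t \<in> S"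
      have "dist (f n t, g n t) (l t, m t) \<le> dist (f n t) (l t) + dist (g n t) (m t)"
        by (simp add: dist_Pair_Pair sqrt_sum_squares_le_sum)
      also have "\<dots> < \<epsilon>" using elim \<open>t \<in> S\<close> by fastforce
      finally show "dist (f n t, g n t) (l t, m t) < \<epsilon>" .
    qed
  qed
qed

text \<open>
  Near a bounded limit all values eventually lie in a compact part of \<open>A\<close>, where \<open>\<Phi>\<close> is
  uniformly continuous.
\<close>

lemma uniform_limit_compose_continuous_on_closed:
  fixes \<Phi> :: "'b::heine_borel \<Rightarrow> 'c::metric_space"
  assumes \<Phi>: "continuous_on A \<Phi>" and "closed A"
    and w: "uniform_limit S w l F" and l: "bounded (l ` S)"
    and wA: "\<And>n t. t \<in> S \<Longrightarrow> w n t \<in> A"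
  shows "uniform_limit S (\<lambda>n t. \<Phi> (w n t)) (\<lambda>t. \<Phi> (l t)) F"
proof -
  obtain c R where R: "\<And>t. t \<in> S \<Longrightarrow> dist c (l t) \<le> R"
    using l unfolding bounded_def by auto
  define K where "K = A \<inter> cball c (R + 1)"
  have "compact K" unfolding K_def
    using \<open>closed A\<close> by (simp add: closed_Int_compact)
  then have "uniformly_continuous_on K \<Phi>"
    using \<Phi> by (auto simp: K_def intro: compact_uniformly_continuous continuous_on_subset)
  moreover have "\<forall>\<^sub>F n in F. \<forall>t\<in>S. w n t \<in> K"
    using uniform_limitD[OF w, of 1]
  proof (rule eventually_mono)
    show "0 < (1::real)" by simp
    fix n assume close: "\<forall>t\<in>S. dist (w n t) (l t) < 1"
    show "\<forall>t\<in>S. w n t \<in> K"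
    proof
      fix t assume t: "t \<in> S"
      have "dist c (w n t) \<le> dist c (l t) + dist (w n t) (l t)"
        by (rule dist_triangle2)
      then show "w n t \<in> K"
        using R[OF t] close wA[OF t] t by (fastforce simp: K_def)
    qed
  qed
  ultimately show ?thesis
    using w compact_imp_closed[OF \<open>compact K\<close>]
    by (auto intro: uniform_limit_compose_uniformly_continuous_on)
qed

lemma uniform_limit_linear_combination:
  fixes c :: "nat \<Rightarrow> 'i \<Rightarrow> real"
  assumes "finite I" and c: "\<And>i. i \<in> I \<Longrightarrow> (\<lambda>n. c n i) \<longlonglongrightarrow> d i"
    and \<phi>: "\<And>i. i \<in> I \<Longrightarrow> bounded (\<phi> i ` S)"
  shows "uniform_limit S (\<lambda>n t. \<Sum>i\<in>I. c n i * \<phi> i t) (\<lambda>t. \<Sum>i\<in>I. d i * \<phi> i t) sequentially"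
  using assms
proof (induction I)
  case empty
  then show ?case by (simp add: uniform_limit_const)
next
  case (insert j I)
  have "uniform_limit S (\<lambda>n t. c n j) (\<lambda>t. d j) sequentially"
    using tendstoD[OF insert.prems(1)[of j]]
    by (auto intro!: uniform_limitI elim: eventually_mono)
  then have "uniform_limit S (\<lambda>n t. c n j * \<phi> j t) (\<lambda>t. d j * \<phi> j t) sequentially"
    using insert.prems(2)[of j]
    by (intro uniform_lim_mult uniform_limit_const) (auto simp: image_constant_conv)
  with insert show ?case by (simp add: uniform_limit_add)
qed

lemma sup_norm_diff_tendsto_0:
  assumes "T > 0" and lim: "uniform_limit {0..T} f l sequentially"
  shows "(\<lambda>n. sup_norm T (f n - l)) \<longlonglongrightarrow> 0"
proof (rule tendstoI)
  fix \<epsilon> :: real assume "\<epsilon> > 0"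
  then have "\<forall>\<^sub>F n in sequentially. \<forall>t\<in>{0..T}. dist (f n t) (l t) < \<epsilon> / 2"
    using uniform_limitD[OF lim, of "\<epsilon> / 2"] by simp
  then show "\<forall>\<^sub>F n in sequentially. dist (sup_norm T (f n - l)) 0 < \<epsilon>"
  proof eventually_elim
    case (elim n)
    then have close: "\<bar>(f n - l) t\<bar> \<le> \<epsilon> / 2" if "t \<in> {0..T}" for t
      using that by (auto simp: dist_real_def less_imp_le)
    then have "sup_norm T (f n - l) \<le> \<epsilon> / 2"
      unfolding sup_norm_def using \<open>T > 0\<close> by (intro cSUP_least) auto
    moreover have "0 \<le> sup_norm T (f n - l)"
      unfolding sup_norm_def
    proof (rule cSUP_upper2)
      show "bdd_above ((\<lambda>t. \<bar>(f n - l) t\<bar>) ` {0..T})"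
        using close by (rule bdd_aboveI2)
      show "0 \<in> {0..T}" using \<open>T > 0\<close> by simp
    qed simp
    ultimately show ?case using \<open>\<epsilon> > 0\<close> by simp
  qed
qed

section \<open>Continuously differentiable functions and the penalty\<close>

lemma C1_fun_has_vector_derivative:
  assumes "f \<in> C1_fun T" "t \<in> {0..T}"
  shows "(f has_vector_derivative deriv_on T f t) (at t within {0..T})"
  using assms unfolding C1_fun_def deriv_on_def by (simp add: vector_derivative_works)

lemma C1_fun_continuous_on: "f \<in> C1_fun T \<Longrightarrow> continuous_on {0..T} f"
  by (auto simp: C1_fun_def continuous_on_eq_continuous_within differentiable_imp_continuous_within)

lemma C1_fun_continuous_on_deriv: "f \<in> C1_fun T \<Longrightarrow> continuous_on {0..T} (deriv_on T f)"
  by (simp add: C1_fun_def)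

lemma bounded_image_continuous_interval:
  "continuous_on {0..T::real} \<phi> \<Longrightarrow> bounded (\<phi> ` {0..T})"
  by (simp add: compact_continuous_image compact_imp_bounded)

text \<open>
  The bound also holds outside \<open>[0, T]\<close>, where functions in \<^term>\<open>C1_fun T\<close> vanish; nodes
  therefore need not lie in the interval.
\<close>

lemma C1_fun_abs_le_sup_norm:
  assumes "T > 0" and f: "f \<in> C1_fun T"
  shows "\<bar>f t\<bar> \<le> sup_norm T f"
proof -
  have "bdd_above ((\<lambda>t. \<bar>f t\<bar>) ` {0..T})"
    using C1_fun_continuous_on[OF f]
    by (intro bounded_imp_bdd_above bounded_image_continuous_interval) (intro continuous_intros)
  then have le: "\<bar>f t\<bar> \<le> sup_norm T f" if "t \<in> {0..T}" for t
    unfolding sup_norm_def using that by (rule cSUP_upper2) auto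
  show ?thesis
  proof (cases "t \<in> {0..T}")
    case False
    then have "f t = 0" using f unfolding C1_fun_def by blast
    then show ?thesis using le[of 0] \<open>T > 0\<close> by auto
  qed (rule le)
qed

lemma deriv_on_linear_combination:
  assumes "T > 0" "t \<in> {0..T}" and e: "\<And>i. i \<in> I \<Longrightarrow> e i \<in> C1_fun T"
    and f: "\<And>t. f t = (\<Sum>i\<in>I. c i * e i t)"
  shows "deriv_on T f t = (\<Sum>i\<in>I. c i * deriv_on T (e i) t)"
proof -
  have "((\<lambda>t. \<Sum>i\<in>I. c i * e i t) has_vector_derivative (\<Sum>i\<in>I. c i * deriv_on T (e i) t))
      (at t within {0..T})"
    using C1_fun_has_vector_derivative[OF e \<open>t \<in> {0..T}\<close>]
    by (intro has_vector_derivative_sum has_vector_derivative_mult_right)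
  moreover have "f = (\<lambda>t. \<Sum>i\<in>I. c i * e i t)" using f by blast
  ultimately show ?thesis
    unfolding deriv_on_def[of T f] using assms(1,2) vector_derivative_within_closed_interval by blast
qed

lemma Ck_on_imp_continuous_on: "Ck_on k f S \<Longrightarrow> continuous_on S f"
  by (cases k)
    (auto simp: continuous_on_eq_continuous_within intro: has_derivative_continuous)

lemma integral_squared_residual_tendsto:
  fixes \<Phi> :: "real \<times> real \<times> real \<Rightarrow> real"
  assumes \<Phi>: "continuous_on (UNIV \<times> UNIV \<times> {0..T}) \<Phi>"
    and lim: "uniform_limit {0..T} du dl sequentially"
      "uniform_limit {0..T} u l sequentially" "uniform_limit {0..T} v m sequentially"
    and cont: "\<And>k. continuous_on {0..T} (du k)" "\<And>k. continuous_on {0..T} (u k)"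
      "\<And>k. continuous_on {0..T} (v k)"
  shows "(\<lambda>k. integral {0..T} (\<lambda>t. (du k t - \<Phi> (u k t, v k t, t))\<^sup>2))
    \<longlonglongrightarrow> integral {0..T} (\<lambda>t. (dl t - \<Phi> (l t, m t, t))\<^sup>2)"
proof -
  define A :: "(real \<times> real \<times> real \<times> real) set" where "A = UNIV \<times> UNIV \<times> UNIV \<times> {0..T}"
  define \<Psi> where "\<Psi> q = (fst q - \<Phi> (snd q))\<^sup>2" for q :: "real \<times> real \<times> real \<times> real"
  have \<Psi>: "continuous_on A \<Psi>"
    unfolding \<Psi>_def A_def
    by (intro continuous_intros continuous_on_compose2[OF \<Phi>]) auto
  have "closed A" unfolding A_def by (intro closed_Times) auto
  have conts: "continuous_on {0..T} dl" "continuous_on {0..T} l" "continuous_on {0..T} m"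
    by (rule uniform_limit_theorem[OF _ lim(1)] uniform_limit_theorem[OF _ lim(2)]
        uniform_limit_theorem[OF _ lim(3)]; simp add: cont)+
  have "uniform_limit {0..T} (\<lambda>k t. \<Psi> (du k t, u k t, v k t, t))
      (\<lambda>t. \<Psi> (dl t, l t, m t, t)) sequentially"
  proof (rule uniform_limit_compose_continuous_on_closed[OF \<Psi> \<open>closed A\<close>])
    show "uniform_limit {0..T} (\<lambda>k t. (du k t, u k t, v k t, t))
        (\<lambda>t. (dl t, l t, m t, t)) sequentially"
      by (intro uniform_limit_Pair lim uniform_limit_const)
    show "bounded ((\<lambda>t. (dl t, l t, m t, t)) ` {0..T})"
      by (intro bounded_image_continuous_interval continuous_intros conts)
  qed (simp add: A_def)
  moreover have "continuous_on {0..T} (\<lambda>t. \<Psi> (du k t, u k t, v k t, t))" for k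
    by (rule continuous_on_compose2[OF \<Psi>])
      (auto simp: A_def intro!: continuous_intros cont)
  ultimately obtain I J where
    I: "\<And>k. ((\<lambda>t. \<Psi> (du k t, u k t, v k t, t)) has_integral I k) {0..T}"
    and J: "((\<lambda>t. \<Psi> (dl t, l t, m t, t)) has_integral J) {0..T}" and "I \<longlonglongrightarrow> J"
    by (rule uniform_limit_integral) auto
  then have "(\<lambda>k. integral {0..T} (\<lambda>t. \<Psi> (du k t, u k t, v k t, t)))
      \<longlonglongrightarrow> integral {0..T} (\<lambda>t. \<Psi> (dl t, l t, m t, t))"
    by (simp only: integral_unique[OF I] integral_unique[OF J])
  then show ?thesis by (simp only: \<Psi>_def fst_conv snd_conv)
qed

section \<open>Compactness and the limit of the maximizers\<close>

text \<open>
  Convergence of two sequences along a common subsequence is obtained in one step, by viewing the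
  pairs of their coordinates as points of the plane.
\<close>

lemma bounded_coordinates_convergent_subsequence:
  fixes a b :: "nat \<Rightarrow> nat \<Rightarrow> real"
  assumes a: "\<And>m i. \<bar>a m i\<bar> \<le> C" and b: "\<And>m i. \<bar>b m i\<bar> \<le> D"
  obtains s \<alpha> \<beta> where "strict_mono (s :: nat \<Rightarrow> nat)"
    "\<And>i. i < N \<Longrightarrow> (\<lambda>k. a (s k) i) \<longlonglongrightarrow> \<alpha> i" "\<And>i. i < N \<Longrightarrow> (\<lambda>k. b (s k) i) \<longlonglongrightarrow> \<beta> i"
proof -
  define f where "f m i = (a m i, b m i)" for m i
  have bounded: "bounded ((\<lambda>h. h i) ` range f)" for i
  proof (rule bounded_subset)
    show "bounded ({-C..C} \<times> {-D..D})" by (intro bounded_Times) auto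
    show "(\<lambda>h. h i) ` range f \<subseteq> {-C..C} \<times> {-D..D}"
      using a b by (fastforce simp: f_def abs_le_iff minus_le_iff)
  qed
  have "\<forall>I\<subseteq>{..<N}. \<exists>l s. strict_mono (s :: nat \<Rightarrow> nat) \<and>
      (\<forall>\<epsilon>>0. \<forall>\<^sub>F k in sequentially. \<forall>i\<in>I. dist (f (s k) i) (l i) < \<epsilon>)"
    by (rule compact_lemma_general[where unproj = "\<lambda>h. h"]) (simp_all only: finite_lessThan bounded)
  then obtain l s where s: "strict_mono (s :: nat \<Rightarrow> nat)"
    and close: "\<And>\<epsilon>. \<epsilon> > 0 \<Longrightarrow> \<forall>\<^sub>F k in sequentially. \<forall>i\<in>{..<N}. dist (f (s k) i) (l i) < \<epsilon>"
    by (meson order_refl)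
  have lim: "(\<lambda>k. f (s k) i) \<longlonglongrightarrow> l i" if "i < N" for i
  proof (rule tendstoI)
    fix \<epsilon> :: real assume "\<epsilon> > 0"
    from close[OF this] show "\<forall>\<^sub>F k in sequentially. dist (f (s k) i) (l i) < \<epsilon>"
      by (rule eventually_mono) (simp add: that)
  qed
  show ?thesis
  proof (rule that[OF s, of "\<lambda>i. fst (l i)" "\<lambda>i. snd (l i)"])
    fix i assume "i < N"
    show "(\<lambda>k. a (s k) i) \<longlonglongrightarrow> fst (l i)"
      using tendsto_fst[OF lim[OF \<open>i < N\<close>]] by (simp add: f_def)
    show "(\<lambda>k. b (s k) i) \<longlonglongrightarrow> snd (l i)"
      using tendsto_snd[OF lim[OF \<open>i < N\<close>]] by (simp add: f_def)
  qed
qed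

lemma fit_nonpos: "(\<And>p. g p \<ge> 0) \<Longrightarrow> fit g n Y \<tau> u \<le> 0"
  unfolding fit_def by (simp add: sum_nonneg)

text \<open>
  Dividing by the weight \<open>c\<close> isolates the penalty; the fit at the maximizer can then be dropped
  because it is nonpositive, so the bound depends on the competitor \<open>p\<close> and \<open>c\<close> alone.
\<close>

lemma penalty_of_arg_max_le:
  fixes H J :: "'a \<Rightarrow> real" and c :: real
  assumes "is_arg_max (\<lambda>p. H p - c * J p) P q" "P p" "c > 0" "H q \<le> 0"
  shows "J q \<le> J p - H p / c"
proof -
  have "H p - c * J p \<le> H q - c * J q"
    using assms(1,2) by (auto simp: is_arg_max_def not_less)
  then have "c * J q \<le> c * J p - H p" using \<open>H q \<le> 0\<close> by linarith
  then show ?thesis using \<open>c > 0\<close> by (simp add: field_simps)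
qed

theorem lemma4:
  fixes T x z :: real
    and \<Theta> :: "(real ^ 'd) set" and \<theta> :: "real ^ 'd"
    and \<Gamma> :: "(real \<times> real) set"
    and F G :: "real \<times> real \<times> real \<times> (real ^ 'd) \<Rightarrow> real"
    and g :: "real \<times> real \<Rightarrow> real"
    and n :: nat and Y \<tau> :: "nat \<Rightarrow> real"
    and L :: "(real \<Rightarrow> real) set"
    and lam :: "nat \<Rightarrow> real"
    and xh zh :: "nat \<Rightarrow> real \<Rightarrow> real"
  assumes "T > 0"
    and "open \<Theta>" "convex \<Theta>"
    and "open \<Gamma>" "convex \<Gamma>"
    and "Ck_on 3 F (UNIV \<times> UNIV \<times> {0..T} \<times> \<Theta>)"
    and "Ck_on 3 G (UNIV \<times> UNIV \<times> {0..T} \<times> \<Theta>)"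
    and "continuous_on UNIV g" "\<And>p. g p \<ge> 0"
    and "n \<ge> 1" "\<And>i. i \<in> {1..n} \<Longrightarrow> \<tau> i \<in> {0..T}"
    and "\<theta> \<in> \<Theta>" "(x, z) \<in> \<Gamma>"
    and "L \<subseteq> C1_fun T" "finite_dim_subspace L"
    and "strict_mono lam" "\<And>m. lam m > 0" "filterlim lam at_top sequentially"
    and "\<And>m. is_arg_max (\<lambda>(u, v). fit g n Y \<tau> u - lam m * ode_penalty T F G \<theta> (u, v))
            (admissible L x z) (xh m, zh m)"
    and "\<exists>C. \<forall>m. sup_norm T (xh m) \<le> C"
    and "\<exists>C. \<forall>m. sup_norm T (zh m) \<le> C"
  shows "\<forall>r :: nat \<Rightarrow> nat. strict_mono r \<longrightarrow>
    (\<exists>(s :: nat \<Rightarrow> nat) xinf zinf. strict_mono s \<and>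
       is_arg_min (ode_penalty T F G \<theta>) (admissible L x z) (xinf, zinf) \<and>
       (\<lambda>k. sup_norm T (xh (r (s k)) - xinf)) \<longlonglongrightarrow> 0 \<and>
       (\<lambda>k. sup_norm T (zh (r (s k)) - zinf)) \<longlonglongrightarrow> 0)"
proof (intro allI impI)
  fix r :: "nat \<Rightarrow> nat"
  assume r: "strict_mono r"
  note T = \<open>T > 0\<close> and L = \<open>L \<subseteq> C1_fun T\<close>
  have "subspace L" using \<open>finite_dim_subspace L\<close> by (simp add: finite_dim_subspace_def)
  \<comment> \<open>The coordinates of a function in \<open>L\<close> are its values at nodes, so a sup bound controls them.\<close>
  obtain B where "finite B" "span B = L"
    using \<open>finite_dim_subspace L\<close> by (auto simp: finite_dim_subspace_def)
  with finite_span_interpolation[of B] obtain N e and p :: "nat \<Rightarrow> real"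
    where e_L: "\<And>i. i < N \<Longrightarrow> e i \<in> L"
    and interp: "\<And>h t. h \<in> L \<Longrightarrow> h t = (\<Sum>i<N. h (p i) * e i t)"
    by metis
  have e_C1: "e i \<in> C1_fun T" if "i < N" for i
    using e_L[OF that] L by blast
  have adm: "admissible L x z (xh m, zh m)" for m
    using assms(19)[of m] by (simp add: is_arg_max_def)
  then have xh_L: "xh m \<in> L" and zh_L: "zh m \<in> L" and "xh m 0 = x" and "zh m 0 = z" for m
    by (simp_all add: admissible_def)
  obtain C D where "\<And>m. sup_norm T (xh m) \<le> C" "\<And>m. sup_norm T (zh m) \<le> D"
    using assms(20,21) by blast
  then have "\<And>m i. \<bar>xh (r m) (p i)\<bar> \<le> C" "\<And>m i. \<bar>zh (r m) (p i)\<bar> \<le> D"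
    using C1_fun_abs_le_sup_norm[OF T] xh_L zh_L L by (meson order_trans subsetD)+
  then obtain s \<alpha> \<beta> where s: "strict_mono (s :: nat \<Rightarrow> nat)"
    and \<alpha>: "\<And>i. i < N \<Longrightarrow> (\<lambda>k. xh (r (s k)) (p i)) \<longlonglongrightarrow> \<alpha> i"
    and \<beta>: "\<And>i. i < N \<Longrightarrow> (\<lambda>k. zh (r (s k)) (p i)) \<longlonglongrightarrow> \<beta> i"
    by (rule bounded_coordinates_convergent_subsequence
        [where N = N and a = "\<lambda>m i. xh (r m) (p i)" and b = "\<lambda>m i. zh (r m) (p i)"]) blast
  define interpolant where "interpolant c = (\<Sum>i<N. c i *\<^sub>R e i)" for c :: "nat \<Rightarrow> real"
  have interpolant: "interpolant c t = (\<Sum>i<N. c i * e i t)" for c t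
    by (simp add: interpolant_def sum_fun_apply scaleR_fun_apply)
  have interpolant_L: "interpolant c \<in> L" for c
    unfolding interpolant_def using \<open>subspace L\<close> e_L by (intro subspace_sum subspace_scale) auto
  \<comment> \<open>For functions in \<open>L\<close>, convergence at the nodes is already \<open>C\<^sup>1\<close> convergence.\<close>
  have C1_limit: "uniform_limit {0..T} h (interpolant c) sequentially"
    "uniform_limit {0..T} (\<lambda>k. deriv_on T (h k)) (deriv_on T (interpolant c)) sequentially"
    if h: "\<And>k. h k \<in> L" and c: "\<And>i. i < N \<Longrightarrow> (\<lambda>k. h k (p i)) \<longlonglongrightarrow> c i" for h c
  proof -
    have "uniform_limit {0..T} (\<lambda>k t. \<Sum>i<N. h k (p i) * e i t) (\<lambda>t. \<Sum>i<N. c i * e i t) sequentially"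
      using c e_C1 by (intro uniform_limit_linear_combination bounded_image_continuous_interval
          C1_fun_continuous_on) auto
    then show "uniform_limit {0..T} h (interpolant c) sequentially"
      by (rule uniform_limit_cong'[THEN iffD1, rotated -1]) (simp_all add: interpolant interp[OF h, symmetric])
    have sums: "uniform_limit {0..T} (\<lambda>k t. \<Sum>i<N. h k (p i) * deriv_on T (e i) t)
        (\<lambda>t. \<Sum>i<N. c i * deriv_on T (e i) t) sequentially"
      using c e_C1 by (intro uniform_limit_linear_combination bounded_image_continuous_interval
          C1_fun_continuous_on_deriv) auto
    have deriv_h: "deriv_on T (h k) t = (\<Sum>i<N. h k (p i) * deriv_on T (e i) t)"
      if "t \<in> {0..T}" for k t
      by (rule deriv_on_linear_combination[OF T that e_C1 interp[OF h]]) simp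
    have deriv_interpolant: "deriv_on T (interpolant c) t = (\<Sum>i<N. c i * deriv_on T (e i) t)"
      if "t \<in> {0..T}" for t
      by (rule deriv_on_linear_combination[OF T that e_C1 interpolant]) simp
    show "uniform_limit {0..T} (\<lambda>k. deriv_on T (h k)) (deriv_on T (interpolant c)) sequentially"
      by (rule uniform_limit_cong'[THEN iffD1, OF _ _ sums]) (simp_all only: deriv_h deriv_interpolant)
  qed
  let ?x = "\<lambda>k. xh (r (s k))" and ?z = "\<lambda>k. zh (r (s k))"
  note x_lim = C1_limit[of ?x, OF xh_L \<alpha>] and z_lim = C1_limit[of ?z, OF zh_L \<beta>]
  have "interpolant \<alpha> 0 = x" "interpolant \<beta> 0 = z"
    using tendsto_uniform_limitI[OF x_lim(1), of 0] tendsto_uniform_limitI[OF z_lim(1), of 0] T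
    by (simp_all add: \<open>\<And>m. xh m 0 = x\<close> \<open>\<And>m. zh m 0 = z\<close> LIMSEQ_const_iff)
  then have adm_limit: "admissible L x z (interpolant \<alpha>, interpolant \<beta>)"
    using interpolant_L by (simp add: admissible_def)
  have slice: "continuous_on (UNIV \<times> UNIV \<times> {0..T}) (\<lambda>(a, b, t). K (a, b, t, \<theta>))"
    if "Ck_on 3 K (UNIV \<times> UNIV \<times> {0..T} \<times> \<Theta>)" for K :: "real \<times> real \<times> real \<times> (real ^ 'd) \<Rightarrow> real"
    unfolding case_prod_beta
    by (rule continuous_on_compose2[OF Ck_on_imp_continuous_on[OF that]])
      (auto intro!: continuous_intros simp: \<open>\<theta> \<in> \<Theta>\<close>)
  have cont: "continuous_on {0..T} (h :: real \<Rightarrow> real)" "continuous_on {0..T} (deriv_on T h)"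
    if "h \<in> L" for h
    using that L C1_fun_continuous_on C1_fun_continuous_on_deriv by blast+
  have J_lim: "(\<lambda>k. ode_penalty T F G \<theta> (?x k, ?z k)) \<longlonglongrightarrow> ode_penalty T F G \<theta> (interpolant \<alpha>, interpolant \<beta>)"
    unfolding ode_penalty_def case_prod_conv
    using integral_squared_residual_tendsto[OF slice[OF assms(6)] x_lim(2,1) z_lim(1)]
      integral_squared_residual_tendsto[OF slice[OF assms(7)] z_lim(2) x_lim(1) z_lim(1)]
    by (intro tendsto_add) (simp_all add: cont xh_L zh_L)
  \<comment> \<open>The competitor bound survives the limit, where the fit, divided by \<open>\<lambda>\<close>, disappears.\<close>
  have "ode_penalty T F G \<theta> (interpolant \<alpha>, interpolant \<beta>) \<le> ode_penalty T F G \<theta> (u, v)"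
    if uv: "admissible L x z (u, v)" for u v
  proof -
    have "filterlim (\<lambda>k. lam (r (s k))) at_top sequentially"
      using filterlim_compose[OF filterlim_compose[OF assms(18) filterlim_subseq[OF r]]
          filterlim_subseq[OF s]] .
    then have "(\<lambda>k. fit g n Y \<tau> u / lam (r (s k))) \<longlonglongrightarrow> 0"
      by (intro tendsto_divide_0[OF tendsto_const] filterlim_at_top_imp_at_infinity)
    then have bound_lim: "(\<lambda>k. ode_penalty T F G \<theta> (u, v) - fit g n Y \<tau> u / lam (r (s k)))
        \<longlonglongrightarrow> ode_penalty T F G \<theta> (u, v) - 0"
      by (intro tendsto_diff tendsto_const)
    have bound: "ode_penalty T F G \<theta> (?x k, ?z k)
        \<le> ode_penalty T F G \<theta> (u, v) - fit g n Y \<tau> u / lam (r (s k))" for k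
      using penalty_of_arg_max_le[where H = "\<lambda>q. fit g n Y \<tau> (fst q)" and J = "ode_penalty T F G \<theta>"
          and c = "lam (r (s k))" and P = "admissible L x z" and q = "(?x k, ?z k)", OF _ uv]
        assms(19)[of "r (s k)"] \<open>\<And>m. lam m > 0\<close> fit_nonpos[of g, OF \<open>\<And>p. g p \<ge> 0\<close>]
      by (simp add: case_prod_beta')
    show ?thesis
      using LIMSEQ_le[OF J_lim bound_lim] bound unfolding diff_0_right by blast
  qed
  then have "is_arg_min (ode_penalty T F G \<theta>) (admissible L x z) (interpolant \<alpha>, interpolant \<beta>)"
    using adm_limit by (auto simp: is_arg_min_linorder)
  then show "\<exists>s xinf zinf. strict_mono s \<and>
       is_arg_min (ode_penalty T F G \<theta>) (admissible L x z) (xinf, zinf) \<and>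
       (\<lambda>k. sup_norm T (xh (r (s k)) - xinf)) \<longlonglongrightarrow> 0 \<and>
       (\<lambda>k. sup_norm T (zh (r (s k)) - zinf)) \<longlonglongrightarrow> 0"
    by (intro exI[of _ s] exI[of _ "interpolant \<alpha>"] exI[of _ "interpolant \<beta>"] conjI s
        sup_norm_diff_tendsto_0[OF T x_lim(1)] sup_norm_diff_tendsto_0[OF T z_lim(1)])
qed

end
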